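(* Let $q$ be a prime power (of any characteristic) and let $O^-(2n,q)$ be the orthogonal group of a nondegenerate quadratic form of minus type on $\mathbb{F}_q^{2n}$, acting naturally on $\mathbb{F}_q^{2n}$. Let $g$ be chosen uniformly at random from $O^-(2n,q)$ and let $Z_n$ be the number of vectors $v\in\mathbb{F}_q^{2n}$ with $gv=v$. Then for every natural number $j$ and every $n\ge j+1$, $$E[Z_n^j]=\prod_{i=1}^{j}\left(q^{i}+1\right).$$ *)

theory Defs
  imports "HOL-Analysis.Analysis" "HOL-Probability.Probability"
begin

text \<open>
  The space \<open>\<F>\<^sub>q\<^sup>m\<close> is rendered as \<open>'a ^ 'm\<close> with \<open>'a\<close> a finite field of cardinality \<open>q\<close> and
  \<open>CARD('m) = m\<close>. All definitions are valid in every characteristic.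
\<close>

definition polar_form :: "('a::field ^ 'm \<Rightarrow> 'a) \<Rightarrow> 'a ^ 'm \<Rightarrow> 'a ^ 'm \<Rightarrow> 'a" where
  "polar_form Q u v = Q (u + v) - Q u - Q v"

definition quadratic_form :: "('a::field ^ 'm \<Rightarrow> 'a) \<Rightarrow> bool" where
  "quadratic_form Q \<longleftrightarrow>
     (\<forall>c v. Q (c *s v) = c\<^sup>2 * Q v) \<and>
     (\<forall>u. Vector_Spaces.linear (*s) (*) (\<lambda>v. polar_form Q u v)) \<and>
     (\<forall>v. Vector_Spaces.linear (*s) (*) (\<lambda>u. polar_form Q u v))"

text \<open>
  Nondegeneracy means that the polar form has trivial radical. In characteristic 2 some authors
  only ask that \<open>Q\<close> have no nonzero zero on the radical; over a finite field and in even
  dimension, the only case needed here, the two conditions agree.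
\<close>

definition nondegenerate_form :: "('a::field ^ 'm \<Rightarrow> 'a) \<Rightarrow> bool" where
  "nondegenerate_form Q \<longleftrightarrow> (\<forall>u. (\<forall>v. polar_form Q u v = 0) \<longrightarrow> u = 0)"

definition totally_singular :: "('a::field ^ 'm \<Rightarrow> 'a) \<Rightarrow> ('a ^ 'm) set \<Rightarrow> bool" where
  "totally_singular Q S \<longleftrightarrow> vec.subspace S \<and> (\<forall>v\<in>S. Q v = 0)"

definition witt_index :: "('a::field ^ 'm \<Rightarrow> 'a) \<Rightarrow> nat" where
  "witt_index Q = Max {vec.dim S | S. totally_singular Q S}"

text \<open>
  A nondegenerate form on a space of dimension \<open>2 n\<close> over a finite field has Witt index \<open>n\<close>
  (plus type) or \<open>n - 1\<close> (minus type).
\<close>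

definition minus_type :: "('a::field ^ 'm \<Rightarrow> 'a) \<Rightarrow> bool" where
  "minus_type Q \<longleftrightarrow>
     quadratic_form Q \<and> nondegenerate_form Q \<and> 2 * (witt_index Q + 1) = CARD('m)"

definition orthogonal_group :: "('a::field ^ 'm \<Rightarrow> 'a) \<Rightarrow> ('a ^ 'm ^ 'm) set" where
  "orthogonal_group Q = {g. invertible g \<and> (\<forall>v. Q (g *v v) = Q v)}"

definition num_fixed_vectors :: "'a::field ^ 'm ^ 'm \<Rightarrow> nat" where
  "num_fixed_vectors g = card {v. g *v v = v}"

end

theory Submission
  imports Defs
begin

text \<open>For a subspace \<open>A\<close> of the space \<open>V\<close> with pointwise stabilizer \<open>H\<close> in the orthogonal group,
  the average of \<open>Z\<^sup>j\<close> over \<open>H\<close> is \<open>|A|\<^sup>j \<Prod>\<^sub>i (q\<^sup>i + 1)\<close>, by induction on \<open>j\<close>. Writing one factor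
  \<open>Z\<close> as a sum over \<open>v\<close> replaces \<open>A\<close> by the span of \<open>A\<close> and \<open>v\<close>. By Witt's theorem the
  \<open>H\<close>-orbit of a vector \<open>v\<close> outside \<open>A\<close> is determined by \<open>Q v\<close> and by the functional that \<open>v\<close> induces
  on \<open>A\<close>, and when \<open>A\<close> is small all \<open>q |A|\<close> values of these invariants occur; hence the average
  for \<open>j + 1\<close> is \<open>|A|\<close> times that for \<open>A\<close> plus \<open>q |A|\<close> times that for a space of size \<open>q |A|\<close>.\<close>

section \<open>Counting in finite vector spaces, and squares in finite fields\<close>

text \<open>All nonempty fibres of \<open>f\<close> in \<open>S\<close> are cosets
  \<open>y + K\<close>. The kernel is described through the fibres, so that the values of
  \<open>f\<close> may also be restricted functions.\<close>

lemma card_eq_card_image_times_kernel: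
  fixes f :: "'b::ab_group_add \<Rightarrow> 'c"
  assumes fin: "finite S" and sub: "K \<subseteq> S"
    and add: "\<And>x k. x \<in> S \<Longrightarrow> k \<in> K \<Longrightarrow> x + k \<in> S"
    and ker: "\<And>x y. x \<in> S \<Longrightarrow> y \<in> S \<Longrightarrow> f x = f y \<longleftrightarrow> x - y \<in> K"
  shows "card S = card (f ` S) * card K"
proof -
  have "card S = (\<Sum>b\<in>f ` S. card {x \<in> S. f x = b})"
    using fin by (subst card_eq_sum, subst sum.image_gen[of S _ f]) auto
  also have "\<dots> = (\<Sum>b\<in>f ` S. card K)"
  proof (rule sum.cong[OF refl])
    fix b assume "b \<in> f ` S"
    then obtain y where y: "y \<in> S" "b = f y" by auto
    have "{x \<in> S. f x = b} = (\<lambda>k. y + k) ` K"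
    proof (intro equalityI subsetI)
      fix x assume "x \<in> {x \<in> S. f x = b}"
      then have "x - y \<in> K" "x = y + (x - y)" using ker y by auto
      then show "x \<in> (\<lambda>k. y + k) ` K" by blast
    next
      fix x assume "x \<in> (\<lambda>k. y + k) ` K"
      then obtain k where "k \<in> K" "x = y + k" by auto
      then show "x \<in> {x \<in> S. f x = b}" using ker[of x y] y add by auto
    qed
    then show "card {x \<in> S. f x = b} = card K" by (simp add: card_image)
  qed
  finally show ?thesis by simp
qed

lemma card_span_insert:
  fixes A :: "('a::{field,finite} ^ 'm) set"
  assumes "v \<notin> vec.span A"
  shows "card (vec.span (insert v A)) = CARD('a) * card (vec.span A)"
proof -
  let ?f = "\<lambda>(c, u). c *s v + u"
  have "inj_on ?f (UNIV \<times> vec.span A)"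
  proof (rule inj_onI, clarsimp)
    fix c u c' u'
    assume u: "u \<in> vec.span A" "u' \<in> vec.span A" and eq: "c *s v + u = c' *s v + u'"
    have *: "(c - c') *s v = u' - u"
      using eq by (simp add: vec.scale_left_diff_distrib algebra_simps)
    have "c = c'"
    proof (rule ccontr)
      assume "c \<noteq> c'"
      then have "v = inverse (c - c') *s ((c - c') *s v)"
        by (simp only: vec.scale_scale left_inverse right_minus_eq vec.scale_one not_False_eq_True)
      also have "\<dots> \<in> vec.span A"
        unfolding * using u by (intro vec.span_scale vec.span_diff)
      finally show False using assms by simp
    qed
    then show "c = c' \<and> u = u'" using eq by simp
  qed
  moreover have "vec.span (insert v A) = ?f ` (UNIV \<times> vec.span A)"
  proof (intro equalityI subsetI)
    fix x assume "x \<in> vec.span (insert v A)"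
    then obtain k where "x - k *s v \<in> vec.span A" using vec.span_breakdown_eq by blast
    moreover have "x = ?f (k, x - k *s v)" by simp
    ultimately show "x \<in> ?f ` (UNIV \<times> vec.span A)" by blast
  next
    fix x assume "x \<in> ?f ` (UNIV \<times> vec.span A)"
    then obtain c u where "u \<in> vec.span A" "x = c *s v + u" by auto
    then show "x \<in> vec.span (insert v A)"
      by (auto simp: vec.span_breakdown_eq intro!: exI[of _ c])
  qed
  ultimately show ?thesis by (simp add: card_image card_cartesian_product)
qed

text \<open>The square 0 has one root and any other square at most two, so there are at least (q +
  1)/2 squares, in every characteristic.\<close>

lemma card_squares_ge:
  "2 * card (range (\<lambda>x::'a::{field,finite}. x\<^sup>2)) \<ge> CARD('a) + 1"
proof -
  let ?S = "range (\<lambda>x::'a. x\<^sup>2)"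
  have "CARD('a) = (\<Sum>b\<in>?S. card {x::'a. x\<^sup>2 = b})"
    by (subst card_eq_sum, subst sum.image_gen[of UNIV _ "\<lambda>x. x\<^sup>2"]) auto
  also have "\<dots> = card {x::'a. x\<^sup>2 = 0} + (\<Sum>b\<in>?S - {0}. card {x::'a. x\<^sup>2 = b})"
    by (rule sum.remove) (auto intro: range_eqI[of _ _ 0])
  also have "\<dots> \<le> 1 + (\<Sum>b\<in>?S - {0}. 2)"
  proof (rule add_mono)
    show "(\<Sum>b\<in>?S - {0}. card {x::'a. x\<^sup>2 = b}) \<le> (\<Sum>b\<in>?S - {0}. 2)"
    proof (rule sum_mono)
      fix b assume "b \<in> ?S - {0}"
      then obtain y where "b = y\<^sup>2" by auto
      then have "{x. x\<^sup>2 = b} \<subseteq> {y, - y}" by (auto simp: power2_eq_iff)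
      from card_mono[OF _ this] have "card {x. x\<^sup>2 = b} \<le> card {y, - y}" by simp
      also have "\<dots> \<le> 2" by (simp add: card_insert_if)
      finally show "card {x. x\<^sup>2 = b} \<le> 2" .
    qed
  qed simp
  also have "\<dots> = 1 + 2 * (card ?S - 1)"
    by (subst sum_constant, subst card_Diff_singleton) (auto intro: range_eqI[of _ _ 0])
  finally have "CARD('a) \<le> 1 + 2 * (card ?S - 1)" .
  moreover have "card ?S > 0" by (simp add: card_gt_0_iff)
  ultimately show ?thesis by linarith
qed

text \<open>Pigeonhole: the values \<open>x^2 * a\<close> and the values \<open>c - y^2 * b\<close>
  each fill more than half of the field, so the two sets meet.\<close>

lemma diagonal_binary_form_surj:
  fixes a b c :: "'a::{field,finite}"
  assumes "a \<noteq> 0" "b \<noteq> 0"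
  shows "\<exists>x y. x\<^sup>2 * a + y\<^sup>2 * b = c"
proof -
  let ?S = "range (\<lambda>x::'a. x\<^sup>2)"
  let ?A = "(\<lambda>s. s * a) ` ?S" and ?B = "(\<lambda>s. c - s * b) ` ?S"
  have "card ?A = card ?S" "card ?B = card ?S"
    using assms by (auto intro!: card_image inj_onI)
  moreover have "card (?A \<union> ?B) \<le> CARD('a)" by (simp add: card_mono)
  moreover have "card (?A \<union> ?B) = card ?A + card ?B" if "?A \<inter> ?B = {}"
    using that by (intro card_Un_disjoint) auto
  ultimately have "?A \<inter> ?B \<noteq> {}" using card_squares_ge[where 'a='a] by fastforce
  then obtain x y where "x\<^sup>2 * a = c - y\<^sup>2 * b" by auto
  then show ?thesis by (intro exI[of _ x] exI[of _ y]) simp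
qed

text \<open>Here \<open>y = - y\<close>, so squaring is injective, hence surjective on a finite
  field.\<close>

lemma char_2_squares_surj:
  fixes c :: "'a::{field,finite}"
  assumes "(2::'a) = 0"
  shows "\<exists>x. x\<^sup>2 = c"
proof -
  have "x + x = 0" for x :: 'a using assms by (metis mult_2 mult_zero_left)
  then have "- x = x" for x :: 'a by (metis minus_unique)
  then have "inj (\<lambda>x::'a. x\<^sup>2)" by (intro injI) (auto simp: power2_eq_iff)
  then have "surj (\<lambda>x::'a. x\<^sup>2)" by (simp add: finite_UNIV_inj_surj)
  then show ?thesis by (metis surjE)
qed

section \<open>Identities for a quadratic form and its polar form\<close>

locale nondegenerate_quadratic_form =
  fixes Q :: "'a::{field,finite} ^ 'm \<Rightarrow> 'a"
  assumes quadratic: "quadratic_form Q" and nondegenerate: "nondegenerate_form Q"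
begin

abbreviation B where "B \<equiv> polar_form Q"

lemma Q_scale: "Q (c *s v) = c\<^sup>2 * Q v"
  using quadratic by (simp add: quadratic_form_def)

lemma Q_add: "Q (u + v) = Q u + Q v + B u v"
  by (simp add: polar_form_def)

lemma B_sym: "B u v = B v u"
  by (simp add: polar_form_def add.commute)

lemma B_add: "B u (v + w) = B u v + B u w" "B (v + w) u = B v u + B w u"
  using quadratic by (simp_all add: quadratic_form_def Vector_Spaces.linear_iff)

lemma B_scale: "B u (c *s v) = c * B u v" "B (c *s v) u = c * B v u"
  using quadratic by (simp_all add: quadratic_form_def Vector_Spaces.linear_iff)

lemma B_0: "B u 0 = 0" "B 0 u = 0"
  using B_scale(1)[of u 0 0] B_scale(2)[of 0 0 u] by simp_all

lemma B_minus: "B u (- v) = - B u v" "B (- v) u = - B v u"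
  using B_add(1)[of u v "- v"] B_add(2)[of v "- v" u] by (simp_all add: B_0 add_eq_0_iff)

lemma B_diff: "B u (v - w) = B u v - B u w" "B (v - w) u = B v u - B w u"
  using B_add(1)[of u v "- w"] B_add(2)[of v "- w" u] by (simp_all add: B_minus)

lemmas B_simps = B_add B_scale B_0 B_minus B_diff

lemma Q_minus: "Q (- v) = Q v"
  using Q_scale[of "- 1" v] by simp

lemma Q_diff: "Q (u - v) = Q u + Q v - B u v"
  using Q_add[of u "- v"] by (simp add: Q_minus B_minus)

lemma B_self: "B v v = 2 * Q v"
proof -
  have "v + v = 2 *s v" using vec.scale_left_distrib[of 1 1 v] by (simp only: one_add_one vec.scale_one)
  then have "B v v = 2\<^sup>2 * Q v - Q v - Q v" by (simp only: polar_form_def Q_scale)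
  also have "\<dots> = 2 * Q v" by algebra
  finally show ?thesis .
qed

lemma B_nondegenerate: "(\<And>v. B u v = 0) \<Longrightarrow> u = 0"
  using nondegenerate by (auto simp: nondegenerate_form_def)

section \<open>Orthogonal complements\<close>

definition perp :: "('a ^ 'm) set \<Rightarrow> ('a ^ 'm) set" where
  "perp A = {x. \<forall>u\<in>A. B x u = 0}"

lemma subspace_perp: "vec.subspace (perp A)"
  by (auto simp: vec.subspace_def perp_def B_simps)

lemma perp_span: "perp (vec.span A) = perp A"
proof
  show "perp (vec.span A) \<subseteq> perp A" by (auto simp: perp_def vec.span_base)
  show "perp A \<subseteq> perp (vec.span A)"
  proof
    fix x assume x: "x \<in> perp A"
    have "B x u = 0" if "u \<in> vec.span A" for u
      using that
    proof (induction rule: vec.span_induct_alt)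
      case base show ?case by (simp add: B_simps)
    next
      case (step c y z) then show ?case using x by (simp add: B_simps perp_def)
    qed
    then show "x \<in> perp (vec.span A)" by (simp add: perp_def)
  qed
qed

text \<open>Orthogonality to \<open>v\<close> is the vanishing of one functional with at most q
  values.\<close>

lemma card_perp_insert: "card (perp A) \<le> CARD('a) * card (perp (insert v A))"
proof -
  have "card (perp A) = card ((\<lambda>x. B x v) ` perp A) * card (perp (insert v A))"
    by (rule card_eq_card_image_times_kernel) (auto simp: perp_def B_simps)
  also have "\<dots> \<le> CARD('a) * card (perp (insert v A))"
    by (intro mult_right_mono card_mono) auto
  finally show ?thesis .
qed

text \<open>A new vector outside the span multiplies the span by q and divides the complement by at
  most q; a vector inside the span changes neither.\<close>

lemma card_span_perp_mono:
  assumes "finite S"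
  shows "card (vec.span A) * card (perp A) \<le> card (vec.span (A \<union> S)) * card (perp (A \<union> S))"
  using assms
proof (induction S)
  case (insert v S)
  let ?C = "A \<union> S"
  have "card (vec.span ?C) * card (perp ?C) \<le> card (vec.span (insert v ?C)) * card (perp (insert v ?C))"
  proof (cases "v \<in> vec.span ?C")
    case True
    then have "vec.span (insert v ?C) = vec.span ?C" by (rule vec.span_redundant)
    then show ?thesis using perp_span by (metis order_refl)
  next
    case False
    then show ?thesis
      using mult_left_mono[OF card_perp_insert[of ?C v], of "card (vec.span ?C)"]
      by (simp add: card_span_insert mult_ac)
  qed
  with insert show ?case by (auto intro: order_trans)
qed simp

lemma perp_UNIV: "perp UNIV = {0}"
  using B_nondegenerate by (auto simp: perp_def B_simps)

text \<open>The product grows from \<open>{}\<close> over \<open>A\<close> to \<open>UNIV\<close>,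
  and at both ends it is the size of the whole space, by nondegeneracy at the upper one.\<close>

lemma card_span_perp: "card (vec.span A) * card (perp A) = CARD('a ^ 'm)"
proof (rule antisym)
  show "card (vec.span A) * card (perp A) \<le> CARD('a ^ 'm)"
    using card_span_perp_mono[of UNIV A] by (simp add: perp_UNIV)
  have "perp {} = UNIV" by (simp add: perp_def)
  then show "CARD('a ^ 'm) \<le> card (vec.span A) * card (perp A)"
    using card_span_perp_mono[of A "{}"] by simp
qed

lemma perp_perp: "perp (perp A) = vec.span A"
proof (rule card_subset_eq[symmetric])
  show "vec.span A \<subseteq> perp (perp A)"
    proof
    fix x assume "x \<in> vec.span A"
    then have "B u x = 0" if "u \<in> perp A" for u
      using that perp_span[of A] unfolding perp_def by blast
    then show "x \<in> perp (perp A)" unfolding perp_def[of "perp A"] by (auto simp: B_sym[of x])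
  qed
  have "vec.span (perp A) = perp A" by (simp add: subspace_perp vec.span_eq_iff)
  then have "card (perp A) * card (perp (perp A)) = card (vec.span A) * card (perp A)"
    using card_span_perp[of A] card_span_perp[of "perp A"] by metis
  moreover have "perp A \<noteq> {}" using vec.subspace_0[OF subspace_perp] by blast
  ultimately show "card (vec.span A) = card (perp (perp A))" by simp
qed simp

text \<open>A vector outside the double complement of \<open>A\<close> pairs nontrivially with some
  vector of \<open>perp A\<close>, which can then be rescaled.\<close>

lemma ex_perp_pairing:
  assumes "v \<notin> vec.span A"
  shows "\<exists>x\<in>perp A. B x v = c"
proof -
  from assms perp_perp[of A] obtain x where x: "x \<in> perp A" "B v x \<noteq> 0"
    by (auto simp: perp_def)
  then show ?thesis
    by (intro bexI[of _ "(c / B v x) *s x"])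
      (auto simp: B_simps B_sym[of x] intro: vec.subspace_scale[OF subspace_perp])
qed

section \<open>Pointwise stabilizers, Witt extension and singular vectors\<close>

definition fixator :: "('a ^ 'm) set \<Rightarrow> ('a ^ 'm ^ 'm) set" where
  "fixator A = {g \<in> orthogonal_group Q. \<forall>u\<in>A. g *v u = u}"

text \<open>Invertibility comes from nondegeneracy: \<open>f\<close> preserves \<open>B\<close>, so
  a vector killed by \<open>f\<close> is orthogonal to everything.\<close>

lemma isometry_matrix:
  assumes add: "\<And>x y. f (x + y) = f x + f y" and scale: "\<And>c x. f (c *s x) = c *s f x"
    and iso: "\<And>x. Q (f x) = Q x" and fixA: "\<And>u. u \<in> A \<Longrightarrow> f u = u"
  shows "\<exists>g\<in>fixator A. \<forall>x. g *v x = f x"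
proof -
  have lin: "Vector_Spaces.linear (*s) (*s) f"
    using add scale by (simp add: Vector_Spaces.linear_iff vec.vector_space_axioms)
  have mf: "matrix f *v x = f x" for x by (rule matrix_works[OF lin])
  have "B (f x) (f y) = B x y" for x y
    using iso[of "x + y"] iso by (simp add: polar_form_def add)
  then have "x = 0" if "f x = 0" for x
    using that B_nondegenerate[of x] B_0 by metis
  then have "inj f" using vec.linear_inj_iff_eq_0 lin by metis
  then have "inj ((*v) (matrix f))" using mf by (simp add: inj_def)
  then have "invertible (matrix f)"
    by (simp add: invertible_left_inverse matrix_left_invertible_injective)
  then show ?thesis using mf iso fixA by (auto simp: fixator_def orthogonal_group_def)
qed

text \<open>Dividing by \<open>Q d\<close> instead of \<open>B d d\<close> makes the formula valid
  in every characteristic; in characteristic 2 it is an orthogonal transvection.\<close>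

lemma reflection:
  assumes d: "Q d \<noteq> 0" and dA: "d \<in> perp A"
  shows "\<exists>g\<in>fixator A. \<forall>x. g *v x = x - (B x d / Q d) *s d"
proof (rule isometry_matrix)
  fix x show "Q (x - (B x d / Q d) *s d) = Q x"
    using d by (simp add: Q_diff Q_scale B_simps power2_eq_square)
next
  fix u assume "u \<in> A"
  then have "B u d = 0" using dA B_sym[of d] by (simp add: perp_def)
  then show "u - (B u d / Q d) *s d = u" by simp
next
  fix x y
  show "x + y - (B (x + y) d / Q d) *s d = x - (B x d / Q d) *s d + (y - (B y d / Q d) *s d)"
    by (simp add: B_add add_divide_distrib)
next
  fix c x
  show "c *s x - (B (c *s x) d / Q d) *s d = c *s (x - (B x d / Q d) *s d)"
    by (simp add: B_scale)
qed

text \<open>With b = \<open>B x d\<close>, adding b a to \<open>x\<close> changes \<open>Q\<close>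
  by b \<open>B x a\<close> + b^2 \<open>Q a\<close>. The coefficient of the singular vector
  \<open>d\<close> is chosen to cancel this.\<close>

lemma Eichler_transformation:
  assumes "Q d = 0" "B a d = 0" and dA: "d \<in> perp A" and aA: "a \<in> perp A"
  shows "\<exists>g\<in>fixator A. \<forall>x. g *v x = x + B x d *s a - (B x a + Q a * B x d) *s d"
proof (rule isometry_matrix)
  fix x show "Q (x + B x d *s a - (B x a + Q a * B x d) *s d) = Q x"
    using assms(1,2) B_self[of d]
    by (simp add: Q_diff Q_add Q_scale B_simps algebra_simps power2_eq_square)
next
  fix u assume "u \<in> A"
  then have "B u d = 0" "B u a = 0" using dA aA B_sym[of d] B_sym[of a] by (simp_all add: perp_def)
  then show "u + B u d *s a - (B u a + Q a * B u d) *s d = u" by simp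
next
  fix x y
  show "x + y + B (x + y) d *s a - (B (x + y) a + Q a * B (x + y) d) *s d
      = x + B x d *s a - (B x a + Q a * B x d) *s d + (y + B y d *s a - (B y a + Q a * B y d) *s d)"
    by (simp add: B_add distrib_left)
next
  fix c x
  show "c *s x + B (c *s x) d *s a - (B (c *s x) a + Q a * B (c *s x) d) *s d
      = c *s (x + B x d *s a - (B x a + Q a * B x d) *s d)"
    by (simp add: B_scale mult_ac)
qed

lemma fixator_mult: "g \<in> fixator A \<Longrightarrow> h \<in> fixator A \<Longrightarrow> g ** h \<in> fixator A"
  by (auto simp: fixator_def orthogonal_group_def invertible_mult simp flip: matrix_vector_mul_assoc)

lemma fixator_inverse:
  assumes "g \<in> fixator A"
  shows "\<exists>h\<in>fixator A. g ** h = mat 1 \<and> h ** g = mat 1"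
proof -
  from assms have g: "invertible g" "\<And>v. Q (g *v v) = Q v" "\<And>u. u \<in> A \<Longrightarrow> g *v u = u"
    by (auto simp: fixator_def orthogonal_group_def)
  then obtain h where h: "g ** h = mat 1" "h ** g = mat 1" by (auto simp: invertible_def)
  have gh: "g *v (h *v v) = v" "h *v (g *v v) = v" for v
    using h by (simp_all add: matrix_vector_mul_assoc)
  have "invertible h" using h by (auto simp: invertible_def)
  moreover have "Q (h *v v) = Q v" for v using g(2)[of "h *v v"] gh by simp
  moreover have "h *v u = u" if "u \<in> A" for u using g(3)[OF that] gh(2)[of u] by simp
  ultimately show ?thesis using h by (auto simp: fixator_def orthogonal_group_def)
qed

lemma fixator_span: "fixator (vec.span A) = fixator A"
proof
  show "fixator (vec.span A) \<subseteq> fixator A" by (auto simp: fixator_def vec.span_base)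
  show "fixator A \<subseteq> fixator (vec.span A)"
  proof
    fix g assume g: "g \<in> fixator A"
    have "g *v u = u" if "u \<in> vec.span A" for u
      using that
    proof (induction rule: vec.span_induct_alt)
      case base show ?case by simp
    next
      case (step c y z)
      then show ?case using g
        by (simp add: fixator_def matrix_vector_right_distrib vector_scalar_commute)
    qed
    then show "g \<in> fixator (vec.span A)" using g by (simp add: fixator_def)
  qed
qed

text \<open>If \<open>w - v\<close> is nonsingular, the reflection in \<open>w - v\<close> sends \<open>v\<close> to \<open>w\<close>. If it is singular, an
  Eichler transformation does, unless \<open>v\<close> lies in the span of \<open>A\<close> and \<open>w - v\<close>; in that case \<open>v\<close> and
  \<open>w\<close> differ by a rescaling of \<open>w - v\<close>, which is a product of two reflections in vectors of a
  hyperbolic plane orthogonal to \<open>A\<close>.\<close>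

lemma Witt_extension:
  assumes v: "v \<notin> vec.span A" and w: "w \<notin> vec.span A" and Qvw: "Q v = Q w"
    and Bvw: "\<And>u. u \<in> A \<Longrightarrow> B v u = B w u"
  shows "\<exists>g\<in>fixator A. g *v v = w"
proof -
  define d where "d = w - v"
  have wd: "w = v + d" by (simp add: d_def)
  have dA: "d \<in> perp A" using Bvw by (simp add: d_def perp_def B_simps)
  have Bvd: "B v d = - Q d" using Qvw unfolding wd Q_add by (simp add: add_eq_0_iff algebra_simps)
  consider "Q d \<noteq> 0" | "Q d = 0" "v \<notin> vec.span (insert d A)" | "Q d = 0" "v \<in> vec.span (insert d A)"
    by blast
  then show ?thesis
  proof cases
    case 1
    from reflection[OF this dA] obtain g where "g \<in> fixator A" "\<And>x. g *v x = x - (B x d / Q d) *s d"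
      by blast
    then show ?thesis using 1 by (intro bexI[of _ g]) (simp_all add: Bvd wd)
  next
    case 2
    \<comment> \<open>Since \<open>B v d = 0\<close>, the transformation sends \<open>v\<close> to
      \<open>v - B v a *s d\<close>; the value -1 turns this into \<open>v + d\<close>.\<close>
    from ex_perp_pairing[OF 2(2), of "-1"] obtain a where a: "a \<in> perp (insert d A)" "B a v = -1"
      by blast
    then have "B a d = 0" "a \<in> perp A" by (auto simp: perp_def)
    from Eichler_transformation[OF 2(1) this(1) dA this(2)] obtain g where
      "g \<in> fixator A" "\<And>x. g *v x = x + B x d *s a - (B x a + Q a * B x d) *s d" by blast
    then show ?thesis using 2 a by (intro bexI[of _ g]) (simp_all add: Bvd wd B_sym[of v a])
  next
    case 3
    then obtain c where "v - c *s d \<in> vec.span A" using vec.span_breakdown_eq by blast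
    then obtain u where u: "u \<in> vec.span A" "v = u + c *s d" by (metis diff_add_cancel)
    have wu: "w = u + (c + 1) *s d" using u by (simp add: wd vec.scale_left_distrib)
    have c: "c \<noteq> 0" "c + 1 \<noteq> 0" using v w u wu by (auto simp del: vector_sadd_rdistrib)
    have dn: "d \<notin> vec.span A" using v u by (auto intro: vec.span_add vec.span_scale)
    from ex_perp_pairing[OF this, of 1] obtain e0 where e0: "e0 \<in> perp A" "B e0 d = 1" by blast
    \<comment> \<open>The correction makes \<open>e\<close> singular and keeps its pairing with
      \<open>d\<close>, so \<open>d\<close> and \<open>e\<close> form a hyperbolic pair in
      \<open>perp A\<close>.\<close>
    define e where "e = e0 - Q e0 *s d"
    have e: "e \<in> perp A" unfolding e_def
      using e0 dA by (intro vec.subspace_diff vec.subspace_scale subspace_perp)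
    have Bed: "B e d = 1" "B d e = 1" using e0 3 B_self[of d] B_sym[of d e] by (simp_all add: e_def B_simps)
    have Qe: "Q e = 0" using e0 3 by (simp add: e_def Q_diff Q_scale B_simps)
    \<comment> \<open>As \<open>Q (d + t *s e) = t\<close>, this reflection sends \<open>d\<close>
      to \<open>-t e\<close> and \<open>e\<close> to \<open>-d/t\<close>. Taking
      \<open>t = c + 1\<close> and then \<open>t = c\<close> multiplies \<open>d\<close> by
      \<open>(c + 1)/c\<close>.\<close>
    have ref: "\<exists>g\<in>fixator A. \<forall>x. g *v x = x - (B x (d + t *s e) / t) *s (d + t *s e)" if "t \<noteq> 0" for t
    proof -
      have "Q (d + t *s e) = t" using 3 Qe Bed by (simp add: Q_add Q_scale B_simps)
      moreover have "d + t *s e \<in> perp A"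
        using dA e by (intro vec.subspace_add vec.subspace_scale subspace_perp)
      ultimately show ?thesis using reflection[of "d + t *s e" A] that by simp
    qed
    obtain g where g: "g \<in> fixator A" "\<And>x. g *v x = x - (B x (d + (c + 1) *s e) / (c + 1)) *s (d + (c + 1) *s e)"
      using ref[OF c(2)] by blast
    obtain h where h: "h \<in> fixator A" "\<And>x. h *v x = x - (B x (d + c *s e) / c) *s (d + c *s e)"
      using ref[OF c(1)] by blast
    have Bdd: "B d d = 0" "B e e = 0" using B_self 3 Qe by simp_all
    have gd: "g *v d = - ((c + 1) *s e)"
      using c by (simp add: g(2) B_simps Bed Bdd del: vector_sadd_rdistrib)
    have he: "h *v e = - (inverse c *s d)"
      using c by (simp add: h(2) B_simps Bed Bdd vec.scale_right_distrib inverse_eq_divide)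
    have fixu: "g *v u = u" "h *v u = u" using g(1) h(1) u(1) fixator_span unfolding fixator_def by blast+
    have gh: "(h ** g) *v v = w"
    proof -
      have "(h ** g) *v v = h *v (g *v v)" by (simp add: matrix_vector_mul_assoc)
      also have "g *v v = u + c *s (g *v d)"
        by (simp add: u(2) matrix_vector_right_distrib fixu vector_scalar_commute)
      also have "\<dots> = u + (- (c * (c + 1))) *s e"
        by (simp add: gd del: vector_sadd_rdistrib)
      also have "h *v \<dots> = u + (- (c * (c + 1))) *s (h *v e)"
        by (simp only: matrix_vector_right_distrib fixu vector_scalar_commute)
      also have "\<dots> = w" using c by (simp add: he wu del: vector_sadd_rdistrib)
      finally show ?thesis .
    qed
    show ?thesis using gh fixator_mult[OF h(1) g(1)] by blast
  qed
qed

text \<open>Three successively orthogonal vectors are chosen in \<open>perp A\<close>; if none is singular, a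
  combination of two (characteristic 2) or of all three (otherwise) is.\<close>

lemma ex_singular_perp:
  assumes card: "CARD('a) ^ 3 * (card (vec.span A))\<^sup>2 \<le> CARD('a ^ 'm)"
  shows "\<exists>s\<in>perp A. s \<notin> vec.span A \<and> Q s = 0"
proof -
  let ?q = "CARD('a)" and ?U = "vec.span A"
  have q: "?q \<ge> 2" using card_mono[of UNIV "{0, 1 :: 'a}"] by simp
  have U: "card ?U > 0" using vec.span_zero by (auto simp: card_gt_0_iff)
  have pA: "?q ^ 3 * card ?U \<le> card (perp A)"
  proof -
    have "card ?U * (?q ^ 3 * card ?U) \<le> card ?U * card (perp A)"
      using card card_span_perp[of A] by (simp add: power2_eq_square mult_ac)
    then show ?thesis using U by simp
  qed
  have ex: "\<exists>x\<in>S. x \<notin> T" if "card T < card S" for S T :: "('a ^ 'm) set"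
    using that by (metis card_mono finite linorder_not_less subsetI)
  have "card ?U < card (perp A)"
  proof -
    have "1 < ?q ^ 3" using q by (intro one_less_power) auto
    then have "1 * card ?U < ?q ^ 3 * card ?U" using U by (intro mult_strict_right_mono)
    then show ?thesis using pA by linarith
  qed
  then obtain u where u: "u \<in> perp A" "u \<notin> ?U" using ex by blast
  have pu: "?q ^ 2 * card ?U \<le> card (perp (insert u A))"
    using order_trans[OF pA card_perp_insert[of A u]] q by (simp add: power3_eq_cube power2_eq_square)
  have "card (vec.span (insert u A)) < card (perp (insert u A))"
  proof -
    have "?q ^ 1 < ?q ^ 2" using q by (intro power_strict_increasing) auto
    then have "?q * card ?U < ?q ^ 2 * card ?U" using U by (intro mult_strict_right_mono) auto
    then show ?thesis using order_less_le_trans[OF _ pu] card_span_insert[OF u(2)] by metis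
  qed
  \<comment> \<open>\<open>v\<close> avoids the span of \<open>A\<close> and \<open>u\<close>, so
    that no \<open>x *s u + v\<close> falls into the span of \<open>A\<close>. For \<open>w\<close>
    below, avoiding the span of \<open>A\<close> suffices.\<close>
  then obtain v where v: "v \<in> perp (insert u A)" "v \<notin> vec.span (insert u A)" using ex by blast
  then have vA: "v \<in> perp A" "B v u = 0" "B u v = 0" by (auto simp: perp_def B_sym)
  have vU: "v \<notin> ?U" using v vec.span_mono[of A "insert u A"] by blast
  have pv: "?q * card ?U \<le> card (perp (insert v (insert u A)))"
    using order_trans[OF pu card_perp_insert[of _ v]] q by (simp add: power2_eq_square)
  have "card ?U < card (perp (insert v (insert u A)))"
    using pv mult_strict_right_mono[of 1 ?q "card ?U"] U q by linarith
  then obtain w where w: "w \<in> perp (insert v (insert u A))" "w \<notin> ?U" using ex by blast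
  then have wA: "w \<in> perp A" "B w u = 0" "B w v = 0" by (auto simp: perp_def)
  show ?thesis
  proof (cases "Q u = 0 \<or> Q v = 0")
    case True then show ?thesis using u vA vU by blast
  next
    case False
    then have Q0: "Q u \<noteq> 0" "Q v \<noteq> 0" by auto
    show ?thesis
    proof (cases "(2::'a) = 0")
      case True
      from char_2_squares_surj[OF this] obtain x where x: "x\<^sup>2 = - Q v / Q u" by blast
      have "x *s u + v \<notin> ?U"
      proof
        assume "x *s u + v \<in> ?U"
        then have "x *s u + v \<in> vec.span (insert u A)" using vec.span_mono[of A "insert u A"] by blast
        then have "(x *s u + v) - x *s u \<in> vec.span (insert u A)"
          by (intro vec.span_diff vec.span_scale) (simp_all add: vec.span_base)
        then show False using v by simp
      qed
      moreover have "x *s u + v \<in> perp A"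
        using u vA by (intro vec.subspace_add vec.subspace_scale subspace_perp)
      moreover have "Q (x *s u + v) = 0" using x Q0 vA by (simp add: Q_add Q_scale B_simps)
      ultimately show ?thesis by blast
    next
      case False
      obtain x y where xy: "x\<^sup>2 * Q u + y\<^sup>2 * Q v + Q w = 0"
        using diagonal_binary_form_surj[OF Q0, of "- Q w"] by (metis add.left_inverse)
      let ?s = "x *s u + y *s v + w"
      have "?s \<notin> ?U"
      proof
        assume s: "?s \<in> ?U"
        \<comment> \<open>Pairing \<open>?s\<close> with \<open>u\<close> and \<open>v\<close>
          leaves \<open>2 x Q u\<close> and \<open>2 y Q v\<close>; both vanish, so
          \<open>?s = w\<close>.\<close>
        have orth: "B z ?s = 0" if "z \<in> perp A" for z
          using that s perp_span[of A] unfolding perp_def by blast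
        have "x * (2 * Q u) = 0" "y * (2 * Q v) = 0"
          using orth[OF u(1)] orth[OF vA(1)] vA wA B_sym[of u w] B_sym[of v w]
          by (simp_all add: B_simps B_self)
        then have "x = 0" "y = 0" using False Q0 by auto
        then show False using s w by simp
      qed
      moreover have "?s \<in> perp A"
        using u vA wA by (intro vec.subspace_add vec.subspace_scale subspace_perp)
      moreover have "Q ?s = 0"
        using xy vA wA B_sym[of u w] B_sym[of v w] by (simp add: Q_add Q_scale B_simps)
      ultimately show ?thesis by blast
    qed
  qed
qed

section \<open>Orbit counting and moments of the number of fixed vectors\<close>

text \<open>Moving along a singular vector \<open>s\<close> of \<open>perp A\<close> adjusts
  \<open>Q v\<close> without changing the functional on \<open>A\<close>, so the two invariants are
  independent. The functionals number |V| / |\<open>perp A\<close>| = |\<open>A\<close>|.\<close>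

lemma card_invariants:
  assumes A: "vec.subspace A" and card: "CARD('a) ^ 3 * (card A)\<^sup>2 \<le> CARD('a ^ 'm)"
  shows "card ((\<lambda>v. (Q v, restrict (B v) A)) ` (- A)) = CARD('a) * card A"
proof -
  let ?\<Psi> = "\<lambda>v. restrict (B v) A"
  have sp: "vec.span A = A" using A by (simp add: vec.span_eq_iff)
  obtain s where s: "s \<in> perp A" "s \<notin> A" "Q s = 0"
    using ex_singular_perp[of A] card unfolding sp by blast
  have "(\<lambda>v. (Q v, ?\<Psi> v)) ` (- A) = UNIV \<times> range ?\<Psi>"
  proof (intro equalityI subsetI)
    fix p :: "'a \<times> ('a ^ 'm \<Rightarrow> 'a)" assume "p \<in> UNIV \<times> range ?\<Psi>"
    then obtain c v0 where p: "p = (c, ?\<Psi> v0)" by auto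
    \<comment> \<open>This normalizes the pairing of \<open>v0 + x\<close> with \<open>s\<close> to
      1: adding \<open>t *s s\<close> then raises \<open>Q\<close> by exactly \<open>t\<close>, and
      the result lies outside \<open>A\<close> because \<open>s\<close> is orthogonal to
      \<open>A\<close>.\<close>
    obtain x where x: "x \<in> perp A" "B x s = 1 - B v0 s"
      using ex_perp_pairing[of s A] s unfolding sp by blast
    define v where "v = v0 + x + (c - Q (v0 + x)) *s s"
    have Bs: "B (v0 + x) s = 1" using x by (simp add: B_simps)
    have "B v s = 1" using Bs s B_self[of s] by (simp add: v_def B_add(2)[of "v0 + x"] B_scale
        del: vector_sub_rdistrib)
    then have "v \<notin> A" using s B_sym by (auto simp: perp_def)
    moreover have "Q v = c"
      using s Bs by (simp add: v_def Q_add[of "v0 + x"] Q_scale B_scale del: vector_sub_rdistrib)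
    moreover have "?\<Psi> v = ?\<Psi> v0"
      using s x by (auto simp: v_def restrict_def fun_eq_iff B_simps perp_def)
    ultimately show "p \<in> (\<lambda>v. (Q v, ?\<Psi> v)) ` (- A)" unfolding p by (auto intro!: image_eqI[of _ _ v])
  qed auto
  moreover have "card (range ?\<Psi>) = card A"
  proof -
    have "CARD('a ^ 'm) = card (range ?\<Psi>) * card (perp A)"
      by (rule card_eq_card_image_times_kernel)
        (auto simp: perp_def restrict_def fun_eq_iff B_simps split: if_splits)
    moreover have "perp A \<noteq> {}" using vec.subspace_0[OF subspace_perp] by blast
    ultimately show ?thesis using card_span_perp[of A] unfolding sp by auto
  qed
  ultimately show ?thesis by (simp add: card_cartesian_product)
qed

text \<open>Orbit-stabilizer: for a fixed \<open>v\<close> in the orbit \<open>W\<close>, the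
  stabilizer of \<open>w\<close> has as many elements as the coset of those \<open>g\<close> taking
  \<open>v\<close> to \<open>w\<close>, and these cosets partition \<open>fixator A\<close>.\<close>

lemma sum_card_stabilizer:
  assumes W: "\<And>g w. g \<in> fixator A \<Longrightarrow> w \<in> W \<Longrightarrow> g *v w \<in> W"
    and trans: "\<And>v w. v \<in> W \<Longrightarrow> w \<in> W \<Longrightarrow> \<exists>g\<in>fixator A. g *v v = w" and "W \<noteq> {}"
  shows "(\<Sum>w\<in>W. card (fixator (insert w A))) = card (fixator A)"
proof -
  obtain v where v: "v \<in> W" using assms by blast
  have "card (fixator (insert w A)) = card {g \<in> fixator A. g *v v = w}" if w: "w \<in> W" for w
  proof -
    obtain g where g: "g \<in> fixator A" "g *v v = w" using trans[OF v w] by blast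
    obtain h where h: "h \<in> fixator A" "g ** h = mat 1" "h ** g = mat 1" using fixator_inverse[OF g(1)] by blast
    have hw: "h *v w = v" using g h by (simp add: matrix_vector_mul_assoc flip: g(2))
    have "bij_betw (\<lambda>k. k ** g) (fixator (insert w A)) {k \<in> fixator A. k *v v = w}"
    proof (rule bij_betw_byWitness[where f' = "\<lambda>k. k ** h"])
      show "\<forall>k\<in>fixator (insert w A). (k ** g) ** h = k"
        using h by (simp flip: matrix_mul_assoc)
      show "\<forall>k\<in>{k \<in> fixator A. k *v v = w}. (k ** h) ** g = k"
        using h by (simp flip: matrix_mul_assoc)
      show "(\<lambda>k. k ** g) ` fixator (insert w A) \<subseteq> {k \<in> fixator A. k *v v = w}"
        using g fixator_mult[OF _ g(1)] by (auto simp: fixator_def simp flip: matrix_vector_mul_assoc)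
      show "(\<lambda>k. k ** h) ` {k \<in> fixator A. k *v v = w} \<subseteq> fixator (insert w A)"
        using hw fixator_mult[OF _ h(1)] by (auto simp: fixator_def simp flip: matrix_vector_mul_assoc)
    qed
    then show ?thesis by (rule bij_betw_same_card)
  qed
  then have "(\<Sum>w\<in>W. card (fixator (insert w A))) = (\<Sum>w\<in>W. card {g \<in> fixator A. g *v v = w})" by simp
  also have "\<dots> = card (\<Union>w\<in>W. {g \<in> fixator A. g *v v = w})"
    by (rule card_UN_disjoint[symmetric]) auto
  also have "(\<Union>w\<in>W. {g \<in> fixator A. g *v v = w}) = fixator A" using W v by auto
  finally show ?thesis .
qed

text \<open>The fibres of the invariants outside \<open>A\<close> are single orbits by Witt's
  theorem. Each contributes \<open>card (fixator A)\<close>, and there are q |\<open>A\<close>| of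
  them.\<close>

lemma sum_card_stabilizer_outside:
  assumes A: "vec.subspace A" and card: "CARD('a) ^ 3 * (card A)\<^sup>2 \<le> CARD('a ^ 'm)"
  shows "(\<Sum>v\<in>- A. card (fixator (insert v A))) = CARD('a) * card A * card (fixator A)"
proof -
  let ?\<Phi> = "\<lambda>v. (Q v, restrict (B v) A)"
  have sp: "vec.span A = A" using A by (simp add: vec.span_eq_iff)
  have "(\<Sum>v\<in>- A. card (fixator (insert v A)))
      = (\<Sum>p\<in>?\<Phi> ` (- A). \<Sum>v\<in>{v \<in> - A. ?\<Phi> v = p}. card (fixator (insert v A)))"
    by (rule sum.image_gen) simp
  also have "\<dots> = (\<Sum>p\<in>?\<Phi> ` (- A). card (fixator A))"
  proof (rule sum.cong[OF refl], rule sum_card_stabilizer)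
    fix p g w assume g: "g \<in> fixator A" and w: "w \<in> {v \<in> - A. ?\<Phi> v = p}"
    have Qg: "Q (g *v x) = Q x" for x using g by (simp add: fixator_def orthogonal_group_def)
    have Bg: "B (g *v x) (g *v y) = B x y" for x y
      using Qg[of "x + y"] Qg by (simp add: polar_form_def matrix_vector_right_distrib)
    have gA: "g *v u = u" if "u \<in> A" for u using g that by (simp add: fixator_def)
    obtain h where h: "h \<in> fixator A" "h ** g = mat 1" using fixator_inverse[OF g] by blast
    have "g *v w \<notin> A"
    proof
      assume "g *v w \<in> A"
      then have "h *v (g *v w) = g *v w" using h by (simp add: fixator_def)
      then have "g *v w = w" using h by (simp add: matrix_vector_mul_assoc)
      then show False using \<open>g *v w \<in> A\<close> w by simp
    qed
    moreover have "B (g *v w) u = B w u" if "u \<in> A" for u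
      using Bg[of w u] gA[OF that] by simp
    ultimately show "g *v w \<in> {v \<in> - A. ?\<Phi> v = p}" using w Qg by (auto simp: restrict_def fun_eq_iff)
  next
    fix p v w assume "v \<in> {v \<in> - A. ?\<Phi> v = p}" "w \<in> {v \<in> - A. ?\<Phi> v = p}"
    then have vw: "v \<notin> A" "w \<notin> A" "?\<Phi> v = ?\<Phi> w" by auto
    then have "B v u = B w u" if "u \<in> A" for u
      using that by (metis (no_types, lifting) prod.inject restrict_apply')
    then show "\<exists>g\<in>fixator A. g *v v = w" using Witt_extension[of v A w] vw by (simp add: sp)
  qed auto
  also have "\<dots> = CARD('a) * card A * card (fixator A)" using card_invariants[OF assms] by simp
  finally show ?thesis .
qed

text \<open>The size bound is shaped for the induction: lowering \<open>j\<close> by one frees a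
  factor q, which pays for enlarging \<open>A\<close> by one dimension.\<close>

lemma sum_fixed_vectors_power:
  assumes "vec.subspace A" and "(CARD('a) ^ (j + 1) * card A)\<^sup>2 \<le> CARD('a ^ 'm)"
  shows "(\<Sum>g\<in>fixator A. num_fixed_vectors g ^ j)
    = card (fixator A) * card A ^ j * (\<Prod>i=1..j. CARD('a) ^ i + 1)"
  using assms
proof (induction j arbitrary: A)
  case (Suc j)
  let ?q = "CARD('a)" and ?P = "\<Prod>i=1..j. CARD('a) ^ i + 1"
  let ?N = "\<lambda>A. \<Sum>g\<in>fixator A. num_fixed_vectors g ^ j"
  have sp: "vec.span A = A" using Suc.prems by (simp add: vec.span_eq_iff)
  have q: "?q \<ge> 1" by (simp add: Suc_leI)
  have card1: "(?q ^ (j + 1) * card A)\<^sup>2 \<le> CARD('a ^ 'm)"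
  proof (rule order_trans[OF _ Suc.prems(2)])
    show "(?q ^ (j + 1) * card A)\<^sup>2 \<le> (?q ^ (Suc j + 1) * card A)\<^sup>2"
      by (intro power_mono mult_right_mono power_increasing) (use q in auto)
  qed
  have card2: "?q ^ 3 * (card A)\<^sup>2 \<le> CARD('a ^ 'm)"
  proof (rule order_trans[OF _ Suc.prems(2)])
    have "?q ^ 3 * (card A)\<^sup>2 \<le> (?q ^ (Suc j + 1))\<^sup>2 * (card A)\<^sup>2"
      unfolding power_mult[symmetric]
      by (intro mult_right_mono power_increasing) (use q in auto)
    then show "?q ^ 3 * (card A)\<^sup>2 \<le> (?q ^ (Suc j + 1) * card A)\<^sup>2"
      by (simp only: power_mult_distrib)
  qed
  have inside: "?N (insert v A) = card (fixator A) * card A ^ j * ?P" if "v \<in> A" for v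
    using Suc.IH[OF Suc.prems(1) card1] that by (simp add: insert_absorb)
  have outside: "?N (insert v A) = card (fixator (insert v A)) * ((?q * card A) ^ j * ?P)" if "v \<in> - A" for v
  proof -
    have c: "card (vec.span (insert v A)) = ?q * card A"
      using card_span_insert[of v A] that sp by simp
    have "(?q ^ (j + 1) * card (vec.span (insert v A)))\<^sup>2 \<le> CARD('a ^ 'm)"
      using Suc.prems(2) by (simp add: c mult_ac)
    from Suc.IH[OF vec.subspace_span this] show ?thesis
      by (simp add: c fixator_span mult.assoc)
  qed
  have "(\<Sum>g\<in>fixator A. num_fixed_vectors g ^ Suc j)
      = (\<Sum>g\<in>fixator A. \<Sum>v\<in>{v. g *v v = v}. num_fixed_vectors g ^ j)"
    by (simp add: num_fixed_vectors_def)
  also have "\<dots> = (\<Sum>v\<in>UNIV. \<Sum>g\<in>{g \<in> fixator A. g *v v = v}. num_fixed_vectors g ^ j)"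
    using sum.swap_restrict[of "fixator A" UNIV "\<lambda>g v. num_fixed_vectors g ^ j" "\<lambda>g v. g *v v = v"] by simp
  also have "\<dots> = (\<Sum>v\<in>UNIV. ?N (insert v A))"
    by (intro sum.cong) (auto simp: fixator_def)
  also have "\<dots> = (\<Sum>v\<in>A. ?N (insert v A)) + (\<Sum>v\<in>- A. ?N (insert v A))"
    using sum.subset_diff[of A UNIV "\<lambda>v. ?N (insert v A)"] by (simp add: Compl_eq_Diff_UNIV)
  also have "(\<Sum>v\<in>A. ?N (insert v A)) = card A * (card (fixator A) * card A ^ j * ?P)"
    using inside by simp
  also have "(\<Sum>v\<in>- A. ?N (insert v A)) = ?q * card A * card (fixator A) * ((?q * card A) ^ j * ?P)"
    using outside sum_card_stabilizer_outside[OF Suc.prems(1) card2]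
    by (simp flip: sum_distrib_right)
  \<comment> \<open>The new factor arises from |A| |A|^j + q |A| (q |A|)^j = |A|^(j+1) (1 +
    q^(j+1)).\<close>
  also have "card A * (card (fixator A) * card A ^ j * ?P) + \<dots>
      = card (fixator A) * card A ^ Suc j * (?P * (?q ^ Suc j + 1))"
    by (simp add: power_mult_distrib algebra_simps)
  also have "?P * (?q ^ Suc j + 1) = (\<Prod>i=1..Suc j. ?q ^ i + 1)" by simp
  finally show ?case .
qed simp

end

theorem theorem4p8:
  fixes Q :: "'a::{field,finite} ^ 'm \<Rightarrow> 'a" and q n j :: nat
  assumes "CARD('a) = q"
    and "CARD('m) = 2 * n"
    and "minus_type Q"
    and "n \<ge> j + 1"
  shows "measure_pmf.expectation (pmf_of_set (orthogonal_group Q))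
           (\<lambda>g. real (num_fixed_vectors g) ^ j) = (\<Prod>i=1..j. (real q ^ i + 1))"
proof -
  interpret nondegenerate_quadratic_form Q
    using assms(3) by unfold_locales (simp_all add: minus_type_def)
  have fixator0: "fixator {0} = orthogonal_group Q" by (simp add: fixator_def)
  \<comment> \<open>For \<open>A = {0}\<close> the size bound reads q^(2(j+1)) \<le> q^(2n), which
    is where \<open>n \<ge> j + 1\<close> enters.\<close>
  have "(q ^ (j + 1))\<^sup>2 \<le> (q ^ n)\<^sup>2"
    using assms(1,4) by (intro power_mono power_increasing) (auto simp: Suc_leI)
  also have "\<dots> = CARD('a ^ 'm)"
    by (simp add: CARD_vec assms(1,2) mult.commute flip: power_mult)
  finally have *: "(\<Sum>g\<in>orthogonal_group Q. num_fixed_vectors g ^ j)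
      = card (orthogonal_group Q) * (\<Prod>i=1..j. q ^ i + 1)"
    using sum_fixed_vectors_power[of "{0}" j] by (simp add: fixator0 assms(1))
  have ne: "mat 1 \<in> orthogonal_group Q" by (auto simp: orthogonal_group_def invertible_def)
  then have pos: "card (orthogonal_group Q) > 0" by (auto simp: card_gt_0_iff)
  have "measure_pmf.expectation (pmf_of_set (orthogonal_group Q)) (\<lambda>g. real (num_fixed_vectors g) ^ j)
      = real (\<Sum>g\<in>orthogonal_group Q. num_fixed_vectors g ^ j) / real (card (orthogonal_group Q))"
    using ne by (subst integral_pmf_of_set) auto
  also have "\<dots> = (\<Prod>i=1..j. (real q ^ i + 1))" using ne pos by (auto simp: * add.commute)
  finally show ?thesis .
qed

end
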